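(* Let $X$ and $Y$ be compact metric spaces and let $j: Y \to X$ be a continuous surjection. Then the following are equivalent: (i) There exists a unique minimal closed set $K \subseteq Y$ such that $j(K) = X$. (ii) The set $\{x \in X : \operatorname{card}(j^{-1}(x)) = 1\}$ is dense in $X$.
   Context: A minimal closed set $K \subseteq Y$ such that $j(K) = X$ means a minimal element, with respect to inclusion, of the family $\{F \subseteq Y : F \text{ is closed and } j(F) = X\}$. Condition (i) says that this family has exactly one minimal element. Here $j^{-1}(x) = \{y \in Y : j(y) = x\}$. *)

theory Defs
  imports "HOL-Analysis.Analysis"
begin

definition closed_full_image_sets ::
  "'b::topological_space set \<Rightarrow> 'a set \<Rightarrow> ('b \<Rightarrow> 'a) \<Rightarrow> 'b set set" where
  "closed_full_image_sets Y X j = {F. closedin (top_of_set Y) F \<and> j ` F = X}"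

definition minimal_member :: "'b set set \<Rightarrow> 'b set \<Rightarrow> bool" where
  "minimal_member \<F> K \<longleftrightarrow> K \<in> \<F> \<and> (\<forall>F\<in>\<F>. F \<subseteq> K \<longrightarrow> F = K)"

end

theory Submission
  imports Defs
begin

text \<open>
  By compactness and Zorn's lemma every closed set with full image contains a minimal one, so a
  unique minimal set is a least one. If singleton fibres are dense, their closure in \<open>Y\<close> is
  least. Conversely let \<open>K\<close> be least. A ball around a point of \<open>K\<close> cannot be removed from \<open>Y\<close>
  without losing surjectivity, hence contains a whole fibre. So for each \<open>r\<close> the open set of
  points whose fibre lies in some ball of radius \<open>r\<close> is dense, and Baire's theorem applies
  to these sets for \<open>r = 1, 1/2, 1/3, \<dots>\<close>.
\<close>

lemma mem_closed_full_image_sets_iff: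
  fixes Y :: "'b::metric_space set"
  assumes "compact Y"
  shows "F \<in> closed_full_image_sets Y X j \<longleftrightarrow> compact F \<and> F \<subseteq> Y \<and> j ` F = X"
  using assms by (auto simp: closed_full_image_sets_def closedin_compact_eq)

text \<open>A finite subfamily of a chain has a least member, which is nonempty; so the finite
  intersection property holds, and compactness of one member carries it to the whole chain.\<close>

lemma compact_Inter_chain_nonempty:
  fixes \<C> :: "'b::t2_space set set"
  assumes "\<C> \<noteq> {}" and compact: "\<And>F. F \<in> \<C> \<Longrightarrow> compact F" and nonempty: "{} \<notin> \<C>"
    and chain: "\<And>F G. F \<in> \<C> \<Longrightarrow> G \<in> \<C> \<Longrightarrow> F \<subseteq> G \<or> G \<subseteq> F"
  shows "\<Inter>\<C> \<noteq> {}"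
proof -
  obtain C where C: "C \<in> \<C>" using assms(1) by blast
  have "C \<inter> \<Inter>\<C> \<noteq> {}"
  proof (rule compact_imp_fip)
    show "compact C" using C compact by blast
    show "closed T" if "T \<in> \<C>" for T using that compact compact_imp_closed by blast
    show "C \<inter> \<Inter>\<F> \<noteq> {}" if "finite \<F>" "\<F> \<subseteq> \<C>" for \<F>
    proof -
      \<comment> \<open>Inserting \<open>C\<close> keeps the finite family nonempty even if
        \<open>\<F>\<close> is empty. In a chain, a minimal member is least.\<close>
      have "\<exists>M\<in>insert C \<F>. \<forall>F\<in>insert C \<F>. F \<subseteq> M \<longrightarrow> M = F"
        by (rule finite_has_minimal) (use that(1) in auto)
      then obtain M where M: "M \<in> insert C \<F>" "\<And>F. F \<in> insert C \<F> \<Longrightarrow> F \<subseteq> M \<Longrightarrow> M = F"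
        by blast
      have "M \<subseteq> F" if "F \<in> insert C \<F>" for F
        using chain[of F M] M that C \<open>\<F> \<subseteq> \<C>\<close> by blast
      then have "M \<subseteq> C \<inter> \<Inter>\<F>" by blast
      moreover have "M \<noteq> {}" using M(1) C \<open>\<F> \<subseteq> \<C>\<close> nonempty by blast
      ultimately show ?thesis by blast
    qed
  qed
  then show ?thesis by blast
qed

lemma compact_fibre:
  fixes j :: "'b::t2_space \<Rightarrow> 'a::t1_space"
  assumes "compact F" "continuous_on F j"
  shows "compact {y \<in> F. j y = x}"
proof -
  have "closedin (top_of_set F) {y \<in> F. j y = x}"
    using continuous_closedin_preimage_constant[OF assms(2), of x] by simp
  then show ?thesis
    using assms(1) closedin_compact by blast
qed

text \<open>Zorn's lemma with intersections as lower bounds. The intersection of a chain still maps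
  onto \<open>X\<close> because, over each point, the fibres within the members form a chain of
  nonempty compact sets.\<close>

lemma exists_minimal_member_subset:
  fixes Y :: "'b::metric_space set" and j :: "'b \<Rightarrow> 'a::metric_space"
  assumes "compact Y" "continuous_on Y j" and F: "F \<in> closed_full_image_sets Y X j"
  obtains K where "minimal_member (closed_full_image_sets Y X j) K" "K \<subseteq> F"
proof -
  define \<A> where "\<A> = {G \<in> closed_full_image_sets Y X j. G \<subseteq> F}"
  note full_iff = mem_closed_full_image_sets_iff[OF assms(1), of _ X j]
  have "\<exists>K\<in>\<A>. \<forall>G\<in>\<A>. G \<subseteq> K \<longrightarrow> G = K"
  proof (rule predicate_Zorn)
    \<comment> \<open>The order is reversed inclusion, so that a maximal element for Zorn is minimal
      for inclusion.\<close>
    show "partial_order_on \<A> (relation_of (\<lambda>G H. H \<subseteq> G) \<A>)"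
      by (rule partial_order_on_relation_ofI) auto
    fix \<C> assume "\<C> \<in> Chains (relation_of (\<lambda>G H. H \<subseteq> G) \<A>)"
    then have sub: "\<C> \<subseteq> \<A>" and chain: "\<And>G H. G \<in> \<C> \<Longrightarrow> H \<in> \<C> \<Longrightarrow> G \<subseteq> H \<or> H \<subseteq> G"
      unfolding Chains_def relation_of_def by auto
    show "\<exists>U\<in>\<A>. \<forall>G\<in>\<C>. U \<subseteq> G"
    proof (cases "\<C> = {}")
      case True
      \<comment> \<open>The empty intersection would be \<open>UNIV\<close>, so \<open>F\<close>
        itself serves as the bound.\<close>
      then show ?thesis using F by (auto simp: \<A>_def)
    next
      case False
      have \<C>: "compact G" "G \<subseteq> Y" "G \<subseteq> F" "j ` G = X" if "G \<in> \<C>" for G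
        using that sub full_iff by (auto simp: \<A>_def)
      have "x \<in> j ` \<Inter>\<C>" if "x \<in> X" for x
      proof -
        have fibre: "compact {y \<in> G. j y = x}" if "G \<in> \<C>" for G
          using compact_fibre[OF \<C>(1)[OF that] continuous_on_subset[OF assms(2) \<C>(2)[OF that]]] .
        have "\<Inter>((\<lambda>G. {y \<in> G. j y = x}) ` \<C>) \<noteq> {}"
        proof (rule compact_Inter_chain_nonempty)
          show "compact G'" if "G' \<in> (\<lambda>G. {y \<in> G. j y = x}) ` \<C>" for G'
            using that fibre by blast
          show "{} \<notin> (\<lambda>G. {y \<in> G. j y = x}) ` \<C>"
            using \<C>(4) \<open>x \<in> X\<close> by blast
          show "G' \<subseteq> H' \<or> H' \<subseteq> G'"
            if sub: "G' \<in> (\<lambda>G. {y \<in> G. j y = x}) ` \<C>" "H' \<in> (\<lambda>G. {y \<in> G. j y = x}) ` \<C>"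
            for G' H'
          proof -
            obtain G H where GH: "G \<in> \<C>" "H \<in> \<C>"
              and eq: "G' = {y \<in> G. j y = x}" "H' = {y \<in> H. j y = x}"
              using sub by blast
            show ?thesis using chain[OF GH] unfolding eq by auto
          qed
        qed (use False in simp)
        then show ?thesis using False by blast
      qed
      moreover have "j ` \<Inter>\<C> \<subseteq> X" using False \<C>(4) by blast
      moreover have "compact (\<Inter>\<C>)"
      proof -
        obtain G where "G \<in> \<C>" using False by blast
        then have "\<Inter>\<C> = G \<inter> \<Inter>\<C>" by blast
        moreover have "closed (\<Inter>\<C>)" using \<C>(1) compact_imp_closed by blast
        ultimately show ?thesis using \<C>(1)[OF \<open>G \<in> \<C>\<close>] compact_Int_closed by metis
      qed
      moreover have "\<Inter>\<C> \<subseteq> Y" "\<Inter>\<C> \<subseteq> F" using False \<C>(2,3) by blast+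
      ultimately have "\<Inter>\<C> \<in> \<A>"
        unfolding \<A>_def full_iff mem_Collect_eq by blast
      then show ?thesis by blast
    qed
  qed
  then obtain K where K: "K \<in> \<A>" "\<And>G. G \<in> \<A> \<Longrightarrow> G \<subseteq> K \<Longrightarrow> G = K" by blast
  then have "minimal_member (closed_full_image_sets Y X j) K"
    unfolding minimal_member_def \<A>_def by blast
  then show ?thesis using that K(1) by (auto simp: \<A>_def)
qed

text \<open>Every member contains a minimal one; if only one minimal set exists, it lies in every
  member. Conversely, a least member lies in any minimal one and hence equals it.\<close>

lemma ex1_minimal_member_iff_least:
  fixes Y :: "'b::metric_space set" and j :: "'b \<Rightarrow> 'a::metric_space"
  assumes "compact Y" "continuous_on Y j"
  shows "(\<exists>!K. minimal_member (closed_full_image_sets Y X j) K) \<longleftrightarrow>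
    (\<exists>K\<in>closed_full_image_sets Y X j. \<forall>F\<in>closed_full_image_sets Y X j. K \<subseteq> F)"
proof
  assume unique: "\<exists>!K. minimal_member (closed_full_image_sets Y X j) K"
  then obtain K where K: "minimal_member (closed_full_image_sets Y X j) K" by blast
  have "K \<subseteq> F" if "F \<in> closed_full_image_sets Y X j" for F
    using exists_minimal_member_subset[OF assms that] unique K by metis
  then show "\<exists>K\<in>closed_full_image_sets Y X j. \<forall>F\<in>closed_full_image_sets Y X j. K \<subseteq> F"
    using K unfolding minimal_member_def by blast
next
  assume "\<exists>K\<in>closed_full_image_sets Y X j. \<forall>F\<in>closed_full_image_sets Y X j. K \<subseteq> F"
  then show "\<exists>!K. minimal_member (closed_full_image_sets Y X j) K"
    unfolding minimal_member_def by (metis subset_antisym)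
qed

text \<open>A closed set with full image must contain the only point of each singleton fibre, hence
  the closure of all such points. That closure has full image, its image being closed and containing
  a dense set.\<close>

lemma least_if_dense_singleton_fibres:
  fixes Y :: "'b::metric_space set" and j :: "'b \<Rightarrow> 'a::metric_space"
  assumes "compact Y" "continuous_on Y j" "j ` Y = X"
    and dense: "top_of_set X closure_of {x \<in> X. card {y \<in> Y. j y = x} = 1} = X"
  shows "\<exists>K\<in>closed_full_image_sets Y X j. \<forall>F\<in>closed_full_image_sets Y X j. K \<subseteq> F"
proof -
  note full_iff = mem_closed_full_image_sets_iff[OF assms(1), of _ X j]
  define D where "D = {x \<in> X. card {y \<in> Y. j y = x} = 1}"
  define E where "E = {y \<in> Y. j y \<in> D}"
  have "closed Y" using assms(1) by (rule compact_imp_closed)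
  then have sub: "closure E \<subseteq> Y" by (intro closure_minimal) (auto simp: E_def)
  then have compact: "compact (closure E)"
    using assms(1) by (metis closed_closure compact_Int_closed inf.absorb_iff2)
  then have "closed (j ` closure E)"
    using sub assms(2) by (meson compact_continuous_image compact_imp_closed continuous_on_subset)
  moreover have "D \<subseteq> j ` closure E"
    using assms(3) closure_subset[of E] by (force simp: E_def D_def)
  ultimately have "closure D \<subseteq> j ` closure E" by (simp add: closure_minimal)
  \<comment> \<open>The relative closure of \<open>D\<close> is
    \<open>X \<inter> closure (X \<inter> D)\<close>, so density in \<open>X\<close> gives
    \<open>X \<subseteq> closure D\<close>.\<close>
  then have "X \<subseteq> j ` closure E"
    using dense closure_mono[of "X \<inter> D" D] unfolding D_def[symmetric] closure_of_subtopology
    by auto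
  then have "closure E \<in> closed_full_image_sets Y X j"
    using sub compact assms(3) by (auto simp: full_iff)
  moreover have "closure E \<subseteq> F" if "F \<in> closed_full_image_sets Y X j" for F
  proof (rule closure_minimal)
    have F: "compact F" "F \<subseteq> Y" "j ` F = X" using that by (auto simp: full_iff)
    show "closed F" using F(1) by (rule compact_imp_closed)
    show "E \<subseteq> F"
    proof
      fix y assume y: "y \<in> E"
      \<comment> \<open>Infinite sets have \<open>card\<close> 0, so \<open>card\<close> 1 does mean
        a one-point fibre.\<close>
      then obtain z where z: "{y' \<in> Y. j y' = j y} = {z}"
        by (auto simp: E_def D_def card_1_singleton_iff)
      have "j y \<in> j ` F" using F(3) y by (simp add: E_def D_def)
      then obtain w where w: "w \<in> F" "j w = j y" by (metis imageE)
      have "w \<in> {y' \<in> Y. j y' = j y}" "y \<in> {y' \<in> Y. j y' = j y}"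
        using w F(2) y by (auto simp: E_def)
      then have "w = y" unfolding z by simp
      then show "y \<in> F" using w(1) by simp
    qed
  qed
  ultimately show ?thesis by blast
qed

lemma dense_singleton_fibres_if_least:
  fixes Y :: "'b::metric_space set" and j :: "'b \<Rightarrow> 'a::metric_space"
  assumes "compact Y" "continuous_on Y j" "j ` Y = X"
    and K: "K \<in> closed_full_image_sets Y X j"
    and least: "\<And>F. F \<in> closed_full_image_sets Y X j \<Longrightarrow> K \<subseteq> F"
  shows "top_of_set X closure_of {x \<in> X. card {y \<in> Y. j y = x} = 1} = X"
proof -
  note full_iff = mem_closed_full_image_sets_iff[OF assms(1), of _ X j]
  have "compact X" using assms(1-3) compact_continuous_image by blast
  have compl: "compact (Y - V)" if "open V" for V
    using assms(1) that by (rule compact_diff)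
  \<comment> \<open>\<open>W V\<close> consists of the points of \<open>X\<close> whose entire fibre
    lies in \<open>V\<close>. In this form it is the complement of a compact image when
    \<open>V\<close> is open.\<close>
  define W where "W V = X - j ` (Y - V)" for V
  have open_W: "openin (top_of_set X) (W V)" if "open V" for V
  proof -
    have "compact (j ` (Y - V))"
      using compl[OF that] assms(2) by (meson Diff_subset compact_continuous_image continuous_on_subset)
    then have "closed (j ` (Y - V))" by (rule compact_imp_closed)
    then show ?thesis unfolding W_def by (simp add: Diff_eq open_Compl openin_open_Int)
  qed
  \<comment> \<open>Otherwise \<open>Y - V\<close> would still map onto \<open>X\<close>, and
    leastness would force \<open>y\<close> into \<open>Y - V\<close>.\<close>
  have W_nonempty: "W V \<noteq> {}" if "open V" "y \<in> K" "y \<in> V" for y V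
  proof
    assume "W V = {}"
    then have "Y - V \<in> closed_full_image_sets Y X j"
      using compl[OF that(1)] assms(3) by (auto simp: full_iff W_def)
    then show False using least that by blast
  qed
  define G where "G n = (\<Union>y. W (ball y (1 / real (Suc n))))" for n
  have dense: "top_of_set X closure_of G n = topspace (top_of_set X)" for n
    unfolding dense_intersects_open
  proof (intro allI impI)
    fix U assume U: "openin (top_of_set X) U \<and> U \<noteq> {}"
    then obtain x where x: "x \<in> U" "x \<in> X" using openin_imp_subset by blast
    then obtain y where y: "y \<in> K" "j y = x" using K by (auto simp: full_iff)
    then have "y \<in> Y" using K by (auto simp: full_iff)
    \<comment> \<open>The preimage of \<open>U\<close> is open only relative to \<open>Y\<close>;
      \<open>T\<close> is an open set of the whole space that cuts it out.\<close>
    obtain T where T: "open T" "T \<inter> Y = j -` U \<inter> Y"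
      using U continuous_on_open_gen[of j Y X] assms(2,3) unfolding openin_open
      by (metis Int_commute image_subset_iff_funcset subset_refl)
    \<comment> \<open>A fibre inside \<open>V\<close> satisfies both demands: the factor
      \<open>T\<close> puts its base point into \<open>U\<close>, and the ball puts it into
      \<open>G n\<close>.\<close>
    define V where "V = T \<inter> ball y (1 / real (Suc n))"
    have "y \<in> V" "open V" using T x y \<open>y \<in> Y\<close> by (auto simp: V_def)
    then obtain x' where x': "x' \<in> W V" using W_nonempty y(1) by blast
    then obtain y' where "y' \<in> Y" "j y' = x'" using assms(3) by (auto simp: W_def)
    then have "x' \<in> U" using x' T(2) by (auto simp: W_def V_def)
    moreover have "x' \<in> G n" using x' by (auto simp: G_def W_def V_def)
    ultimately show "G n \<inter> U \<noteq> {}" by blast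
  qed
  have "top_of_set X closure_of \<Inter>(range G) = topspace (top_of_set X)"
  proof (rule Baire_category)
    \<comment> \<open>The second alternative holds, since \<open>X\<close> is compact and
      metrizable.\<close>
    show "completely_metrizable_space (top_of_set X) \<or>
      locally_compact_space (top_of_set X) \<and> regular_space (top_of_set X)"
      using \<open>compact X\<close>
      by (simp add: compact_imp_locally_compact_space compact_space_subtopology
          metrizable_imp_regular_space metrizable_space_subtopology metrizable_space_euclidean)
    show "openin (top_of_set X) T \<and> top_of_set X closure_of T = topspace (top_of_set X)"
      if "T \<in> range G" for T
      using that dense open_W by (auto simp: G_def)
  qed simp
  moreover have "\<Inter>(range G) \<subseteq> {x \<in> X. card {y \<in> Y. j y = x} = 1}"
  proof
    fix x assume x: "x \<in> \<Inter>(range G)"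
    then have "x \<in> X" by (auto simp: G_def W_def)
    then obtain y where y: "y \<in> Y" "j y = x" using assms(3) by blast
    have "z = y" if z: "z \<in> Y" "j z = x" for z
    proof (rule ccontr)
      assume "z \<noteq> y"
      \<comment> \<open>Half the distance suffices: two points of a ball of radius \<open>r\<close>
        are less than \<open>2 * r\<close> apart, whatever its centre \<open>c\<close>.\<close>
      then obtain n where n: "1 / real (Suc n) < dist z y / 2"
        using nat_approx_posE[of "dist z y / 2"] by auto
      have "x \<in> G n" using x by blast
      then obtain c where "x \<in> W (ball c (1 / real (Suc n)))" unfolding G_def by blast
      then have "\<And>u. u \<in> Y \<Longrightarrow> j u = x \<Longrightarrow> u \<in> ball c (1 / real (Suc n))"
        unfolding W_def by blast
      then have "dist c z < 1 / real (Suc n)" "dist c y < 1 / real (Suc n)"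
        using y z unfolding mem_ball by blast+
      then show False using n dist_triangle3[of z y c] by linarith
    qed
    then have "{y \<in> Y. j y = x} = {y}" using y by blast
    then show "x \<in> {x \<in> X. card {y \<in> Y. j y = x} = 1}" using \<open>x \<in> X\<close> by simp
  qed
  ultimately have "X \<subseteq> top_of_set X closure_of {x \<in> X. card {y \<in> Y. j y = x} = 1}"
    using closure_of_mono by fastforce
  then show ?thesis using closure_of_subset_topspace by fastforce
qed

theorem theorem4p2:
  fixes X :: "'a::metric_space set" and Y :: "'b::metric_space set" and j :: "'b \<Rightarrow> 'a"
  assumes "compact X" and "compact Y"
    and "continuous_on Y j" and "j ` Y = X"
  shows "(\<exists>!K. minimal_member (closed_full_image_sets Y X j) K) \<longleftrightarrow>
    top_of_set X closure_of {x \<in> X. card {y \<in> Y. j y = x} = 1} = X"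
  unfolding ex1_minimal_member_iff_least[OF assms(2,3)]
proof
  assume "\<exists>K\<in>closed_full_image_sets Y X j. \<forall>F\<in>closed_full_image_sets Y X j. K \<subseteq> F"
  then obtain K where K: "K \<in> closed_full_image_sets Y X j"
    and least: "\<And>F. F \<in> closed_full_image_sets Y X j \<Longrightarrow> K \<subseteq> F"
    by blast
  then show "top_of_set X closure_of {x \<in> X. card {y \<in> Y. j y = x} = 1} = X"
    by (rule dense_singleton_fibres_if_least[OF assms(2-4)])
qed (rule least_if_dense_singleton_fibres[OF assms(2-4)])

end
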